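(* Let $\Omega\subset\mathbb{R}^N$ ($N\geq 1$) be open and let $M$ be a $\Phi$-function on $\Omega$ which is locally integrable, i.e. $\int_K M(x,c)\,dx<\infty$ for every constant $c>0$ and every compact set $K\subset\Omega$. Then the space $E_M(\Omega)$, with the norm $\|\cdot\|_{L_M(\Omega)}$, is separable.
   Context: A function $M:\Omega\times[0,\infty)\to[0,\infty]$ is a $\phi$-function if for all $x\in\Omega$ the function $M(x,\cdot)$ is nondecreasing and convex with $M(x,0)=0$, $M(x,s)>0$ for $s>0$, $M(x,s)\to\infty$ as $s\to\infty$, and $M(\cdot,s)$ is measurable for every $s\geq0$. It is a $\Phi$-function if moreover $\lim_{s\to0^+}M(x,s)/s=0$ and $\lim_{s\to+\infty}M(x,s)/s=+\infty$ for all $x\in\Omega$. $L_M(\Omega)$ is the space of measurable $u:\Omega\to\mathbb{R}$ (modulo a.e. equality) with $\int_\Omega M(x,|u(x)|/\lambda)\,dx<\infty$ for some $\lambda>0$, with the Luxemburg norm $\|u\|_{L_M(\Omega)}=\inf\{\lambda>0:\int_\Omega M(x,|u(x)|/\lambda)\,dx\leq1\}$. $E_M(\Omega)$ is the subset of those $u$ with $\int_\Omega M(x,|u(x)|/\lambda)\,dx<\infty$ for all $\lambda>0$. *)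

theory Defs
  imports "HOL-Analysis.Analysis"
begin

(* Values of M outside \<Omega> \<times> [0,\<infinity>) are irrelevant throughout.  In the convexity clause
   0 * \<infinity> = 0, the convention of ennreal.  Measurability is Lebesgue measurability. *)
definition phi_function :: "(real ^ 'n) set \<Rightarrow> (real ^ 'n \<Rightarrow> real \<Rightarrow> ennreal) \<Rightarrow> bool"
  where "phi_function \<Omega> M \<longleftrightarrow>
    (\<forall>x\<in>\<Omega>.
        mono_on {0..} (M x) \<and>
        (\<forall>s\<ge>0. \<forall>t\<ge>0. \<forall>\<theta>\<in>{0..1}.
           M x (\<theta> * s + (1 - \<theta>) * t) \<le> ennreal \<theta> * M x s + ennreal (1 - \<theta>) * M x t) \<and>
        M x 0 = 0 \<and>
        (\<forall>s>0. M x s > 0) \<and>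
        (M x \<longlongrightarrow> \<infinity>) at_top) \<and>
    (\<forall>s\<ge>0. (\<lambda>x. M x s) \<in> borel_measurable (lebesgue_on \<Omega>))"

definition Phi_function :: "(real ^ 'n) set \<Rightarrow> (real ^ 'n \<Rightarrow> real \<Rightarrow> ennreal) \<Rightarrow> bool"
  where "Phi_function \<Omega> M \<longleftrightarrow>
    phi_function \<Omega> M \<and>
    (\<forall>x\<in>\<Omega>. ((\<lambda>s. M x s / ennreal s) \<longlongrightarrow> 0) (at_right 0) \<and>
             ((\<lambda>s. M x s / ennreal s) \<longlongrightarrow> \<infinity>) at_top)"

definition locally_integrable_phi ::
    "(real ^ 'n) set \<Rightarrow> (real ^ 'n \<Rightarrow> real \<Rightarrow> ennreal) \<Rightarrow> bool"
  where "locally_integrable_phi \<Omega> M \<longleftrightarrow>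
    (\<forall>c>0. \<forall>K. compact K \<and> K \<subseteq> \<Omega> \<longrightarrow> (\<integral>\<^sup>+x. M x c \<partial>(lebesgue_on K)) < \<infinity>)"

definition modular ::
    "(real ^ 'n) set \<Rightarrow> (real ^ 'n \<Rightarrow> real \<Rightarrow> ennreal) \<Rightarrow> (real ^ 'n \<Rightarrow> real) \<Rightarrow> real \<Rightarrow> ennreal"
  where "modular \<Omega> M u r = (\<integral>\<^sup>+x. M x (\<bar>u x\<bar> / r) \<partial>(lebesgue_on \<Omega>))"

definition luxemburg_norm ::
    "(real ^ 'n) set \<Rightarrow> (real ^ 'n \<Rightarrow> real \<Rightarrow> ennreal) \<Rightarrow> (real ^ 'n \<Rightarrow> real) \<Rightarrow> real"
  where "luxemburg_norm \<Omega> M u = Inf {r. r > 0 \<and> modular \<Omega> M u r \<le> 1}"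

(* The functions themselves, before identification up to a.e. equality. *)
definition L_functions ::
    "(real ^ 'n) set \<Rightarrow> (real ^ 'n \<Rightarrow> real \<Rightarrow> ennreal) \<Rightarrow> (real ^ 'n \<Rightarrow> real) set"
  where "L_functions \<Omega> M =
    {u \<in> borel_measurable (lebesgue_on \<Omega>). \<exists>r>0. modular \<Omega> M u r < \<infinity>}"

definition E_functions ::
    "(real ^ 'n) set \<Rightarrow> (real ^ 'n \<Rightarrow> real \<Rightarrow> ennreal) \<Rightarrow> (real ^ 'n \<Rightarrow> real) set"
  where "E_functions \<Omega> M = {u \<in> L_functions \<Omega> M. \<forall>r>0. modular \<Omega> M u r < \<infinity>}"

(* Functions are total in HOL; since only the values on \<Omega> are compared, a class contains
   all extensions of its members from \<Omega> to the whole space. *)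
definition ae_eq :: "(real ^ 'n) set \<Rightarrow> ((real ^ 'n \<Rightarrow> real) \<times> (real ^ 'n \<Rightarrow> real)) set"
  where "ae_eq \<Omega> =
    {(u, v). u \<in> borel_measurable (lebesgue_on \<Omega>) \<and> v \<in> borel_measurable (lebesgue_on \<Omega>) \<and>
             (AE x in lebesgue_on \<Omega>. u x = v x)}"

definition E_space ::
    "(real ^ 'n) set \<Rightarrow> (real ^ 'n \<Rightarrow> real \<Rightarrow> ennreal) \<Rightarrow> (real ^ 'n \<Rightarrow> real) set set"
  where "E_space \<Omega> M = E_functions \<Omega> M // ae_eq \<Omega>"

(* The metric of the Luxemburg norm on classes; modular, hence the norm, is unchanged under
   a.e. modification, so the chosen representatives do not matter.  The value 0 off E_space
   is there because Metric_space asks for nonnegativity on the whole type. *)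
definition E_dist ::
    "(real ^ 'n) set \<Rightarrow> (real ^ 'n \<Rightarrow> real \<Rightarrow> ennreal) \<Rightarrow>
     (real ^ 'n \<Rightarrow> real) set \<Rightarrow> (real ^ 'n \<Rightarrow> real) set \<Rightarrow> real"
  where "E_dist \<Omega> M A B =
    (if A \<in> E_space \<Omega> M \<and> B \<in> E_space \<Omega> M
     then luxemburg_norm \<Omega> M (\<lambda>x. (SOME u. u \<in> A) x - (SOME v. v \<in> B) x)
     else 0)"

end

theory Submission
  imports Defs
begin

text \<open>
  Local integrability makes \<open>M x\<close> finite for almost every \<open>x\<close>; being convex it is then continuous,
  so composition with \<open>M\<close> preserves measurability and dominated convergence applies to the modular.
  Truncating \<open>u\<close> in height and to the sets of a compact exhaustion approximates it in norm by bounded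
  functions with compact support \<open>K\<close>.  Such a function is an a.e. limit of continuous functions, and
  each of these is uniformly close on \<open>K\<close> to a step function built from finitely many sets of a
  countable basis with rational values.  Clamped to the height of the truncation and cut off outside
  \<open>K\<close>, these step functions are dominated by a multiple of the indicator of \<open>K\<close>, which lies in
  \<open>E\<close> by local integrability; so they converge in norm, and there are countably many of them.
\<close>

section \<open>Measurability up to null sets\<close>

lemma (in complete_measure) measurable_cong_AE_complete:
  assumes f: "f \<in> measurable M N" and ae: "AE x in M. f x = g x"
    and g: "g \<in> space M \<rightarrow> space N"
  shows "g \<in> measurable M N"
proof (rule measurableI)
  fix A assume A: "A \<in> sets N"
  \<comment> \<open>The two preimages differ only inside a null set, so completeness carries
    measurability from one to the other.\<close>
  have "AE x in M. x \<in> f -` A \<inter> space M \<longleftrightarrow> x \<in> g -` A \<inter> space M"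
    using ae by eventually_elim auto
  then show "g -` A \<inter> space M \<in> sets M"
    using measurable_sets[OF f A] by (rule in_sets_AE) auto
qed (use g in auto)

lemma complete_measure_lebesgue_on:
  assumes "S \<in> sets lebesgue"
  shows "complete_measure (lebesgue_on S)"
proof
  fix A B assume "B \<subseteq> A" "A \<in> null_sets (lebesgue_on S)"
  then have "A \<subseteq> S" "A \<in> null_sets lebesgue"
    using null_sets_restrict_space[OF assms] by auto
  then have "B \<in> null_sets lebesgue"
    using \<open>B \<subseteq> A\<close> null_sets_completion_subset by blast
  then show "B \<in> sets (lebesgue_on S)"
    using \<open>B \<subseteq> A\<close> \<open>A \<subseteq> S\<close> assms by (auto simp: sets_restrict_space_iff)
qed

section \<open>Step functions over a topological basis\<close>

primrec step_fun :: "('a set \<times> real) list \<Rightarrow> 'a \<Rightarrow> real"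
  where
    "step_fun [] x = 0"
  | "step_fun (p # L) x = (if x \<in> fst p then snd p else step_fun L x)"

text \<open>The sets in the list may overlap: every value attached to a set containing
  \<open>x\<close> is within \<open>e\<close> of \<open>g x\<close>, so it is harmless that the
  first match decides.\<close>

lemma step_fun_close:
  assumes "\<And>p y. p \<in> set L \<Longrightarrow> y \<in> fst p \<Longrightarrow> \<bar>g y - snd p\<bar> < e"
    and "x \<in> (\<Union>p\<in>set L. fst p)"
  shows "\<bar>g x - step_fun L x\<bar> < e"
  using assms by (induction L) auto

lemma borel_measurable_step_fun:
  assumes "\<And>p. p \<in> set L \<Longrightarrow> fst p \<in> sets M"
  shows "step_fun L \<in> borel_measurable M"
  using assms
proof (induction L)
  case Nil
  have "step_fun [] = (\<lambda>x::'a. 0)"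
    by auto
  then show ?case by simp
next
  case (Cons p L)
  then have [measurable]: "step_fun L \<in> borel_measurable M" "fst p \<in> sets M"
    by auto
  have "step_fun (p # L) = (\<lambda>x. if x \<in> fst p then snd p else step_fun L x)"
    by auto
  also have "\<dots> \<in> borel_measurable M"
    by measurable
  finally show ?case .
qed

text \<open>By continuity each point lies in a basis set on all of which \<open>g\<close> stays
  within \<open>e\<close> of a single rational. Such sets cover \<open>K\<close>, and a finite
  subcover, listed in any order, gives the step function. A countable basis leaves only countably
  many lists to choose from.\<close>

lemma continuous_approx_step_fun:
  fixes g :: "'a::topological_space \<Rightarrow> real"
  assumes B: "topological_basis B" and K: "compact K"
    and g: "continuous_on UNIV g" and e: "e > 0"
  obtains L where "L \<in> lists (B \<times> \<rat>)" "\<And>x. x \<in> K \<Longrightarrow> \<bar>g x - step_fun L x\<bar> < e"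
proof -
  define P where "P = {p \<in> B \<times> \<rat>. \<forall>y\<in>fst p. \<bar>g y - snd p\<bar> < e}"
  have "\<exists>p\<in>P. x \<in> fst p" for x
  proof -
    obtain q where q: "q \<in> \<rat>" "g x < q" "q < g x + e"
      using Rats_dense_in_real[of "g x" "g x + e"] e by auto
    have "open (g -` {q - e <..< q + e})"
      using g by (simp add: continuous_on_open_vimage open_vimage)
    moreover have "x \<in> g -` {q - e <..< q + e}"
      using q by auto
    ultimately obtain U where "U \<in> B" "x \<in> U" "U \<subseteq> g -` {q - e <..< q + e}"
      using topological_basisE[OF B] by metis
    then show ?thesis
      using q by (intro bexI[of _ "(U, q)"]) (force simp: P_def abs_less_iff)+
  qed
  then have "K \<subseteq> (\<Union>p\<in>P. fst p)"
    by blast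
  moreover have "open (fst p)" if "p \<in> P" for p
    using that topological_basis_open[OF B] by (auto simp: P_def)
  ultimately obtain C where C: "C \<subseteq> P" "finite C" "K \<subseteq> (\<Union>p\<in>C. fst p)"
    using compactE_image[OF K] by metis
  obtain L where L: "set L = C"
    using finite_list[OF C(2)] by blast
  show ?thesis
  proof
    show "L \<in> lists (B \<times> \<rat>)"
      using C L by (auto simp: P_def)
    show "\<bar>g x - step_fun L x\<bar> < e" if "x \<in> K" for x
      using C that unfolding L[symmetric] by (intro step_fun_close) (auto simp: P_def)
  qed
qed

section \<open>Pointwise behaviour of \<open>M\<close> and measurability of compositions\<close>

locale phi_modular =
  fixes \<Omega> :: "(real ^ 'n) set" and M :: "real ^ 'n \<Rightarrow> real \<Rightarrow> ennreal"
  assumes open_\<Omega>: "open \<Omega>"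
    and phi: "phi_function \<Omega> M"
    and loc: "locally_integrable_phi \<Omega> M"
begin

lemma sets_\<Omega>: "\<Omega> \<in> sets lebesgue"
  using open_\<Omega> by (simp add: lmeasurable_open)

lemma M_mono: "x \<in> \<Omega> \<Longrightarrow> 0 \<le> s \<Longrightarrow> s \<le> t \<Longrightarrow> M x s \<le> M x t"
  using phi by (auto simp: phi_function_def mono_on_def)

lemma M_convex:
  "x \<in> \<Omega> \<Longrightarrow> 0 \<le> s \<Longrightarrow> 0 \<le> t \<Longrightarrow> 0 \<le> \<theta> \<Longrightarrow> \<theta> \<le> 1 \<Longrightarrow>
    M x (\<theta> * s + (1 - \<theta>) * t) \<le> ennreal \<theta> * M x s + ennreal (1 - \<theta>) * M x t"
  using phi by (auto simp: phi_function_def)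

lemma M_zero: "x \<in> \<Omega> \<Longrightarrow> M x 0 = 0"
  using phi by (auto simp: phi_function_def)

lemma M_pos: "x \<in> \<Omega> \<Longrightarrow> s > 0 \<Longrightarrow> M x s > 0"
  using phi by (auto simp: phi_function_def)

lemma M_measurable: "s \<ge> 0 \<Longrightarrow> (\<lambda>x. M x s) \<in> borel_measurable (lebesgue_on \<Omega>)"
  using phi by (auto simp: phi_function_def)

text \<open>Convexity against the point 0, where \<open>M x\<close> vanishes. This linear bound
  yields both the scaling of the modular and the continuity of \<open>M x\<close> at 0.\<close>

lemma M_scale:
  assumes "x \<in> \<Omega>" "0 \<le> s" "0 \<le> \<theta>" "\<theta> \<le> 1"
  shows "M x (\<theta> * s) \<le> ennreal \<theta> * M x s"
  using M_convex[OF assms(1,2) order.refl assms(3,4)] M_zero[OF assms(1)] by simp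

text \<open>On each compact set of an exhaustion a finite integral forces finite values a.e.
  Countably many sets and integer arguments produce one common null set, and monotonicity passes
  from integers to all \<open>s\<close>.\<close>

lemma AE_M_finite: "AE x in lebesgue_on \<Omega>. \<forall>s\<ge>0. M x s < \<infinity>"
proof -
  obtain C :: "nat \<Rightarrow> (real ^ 'n) set" where C: "\<And>n. compact (C n)" "\<And>n. C n \<subseteq> \<Omega>" "\<Union>(range C) = \<Omega>"
    by (rule open_Union_compact_subsets[OF open_\<Omega>]) (rule that)
  \<comment> \<open>\<open>Suc k\<close> keeps the constant positive, as local integrability speaks
    of positive constants.\<close>
  have "AE x in lebesgue. x \<in> C n \<longrightarrow> M x (real (Suc k)) \<noteq> \<infinity>" for n k :: nat
  proof -
    have Cn: "C n \<in> sets lebesgue"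
      using C(1)[of n] by (simp add: lmeasurable_compact fmeasurableD)
    have "(\<lambda>x. M x (real (Suc k))) \<in> borel_measurable (lebesgue_on (C n))"
      by (rule measurable_restrict_mono[OF M_measurable C(2)]) simp
    moreover have "(\<integral>\<^sup>+x. M x (real (Suc k)) \<partial>(lebesgue_on (C n))) \<noteq> \<infinity>"
      using loc C unfolding locally_integrable_phi_def
      by (metis of_nat_0_less_iff zero_less_Suc less_irrefl)
    ultimately have "AE x in lebesgue_on (C n). M x (real (Suc k)) \<noteq> \<infinity>"
      by (rule nn_integral_PInf_AE)
    then show ?thesis
      using Cn by (simp add: AE_restrict_space_iff)
  qed
  then have "AE x in lebesgue. \<forall>n k. x \<in> C n \<longrightarrow> M x (real (Suc k)) \<noteq> \<infinity>"
    unfolding AE_all_countable by blast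
  then have "AE x in lebesgue. x \<in> \<Omega> \<longrightarrow> (\<forall>s\<ge>0. M x s < \<infinity>)"
  proof eventually_elim
    case (elim x)
    show ?case
    proof (intro impI allI)
      fix s :: real assume "x \<in> \<Omega>" "s \<ge> 0"
      obtain k where "s \<le> real (Suc k)"
        by (metis real_arch_simple of_nat_le_iff le_SucI order.refl order.trans)
      then have "M x s \<le> M x (real (Suc k))"
        using \<open>x \<in> \<Omega>\<close> \<open>s \<ge> 0\<close> by (intro M_mono)
      also have "\<dots> < \<infinity>"
        using elim \<open>x \<in> \<Omega>\<close> C(3) by (auto simp: less_top)
      finally show "M x s < \<infinity>" .
    qed
  qed
  then show ?thesis
    using sets_\<Omega> by (simp add: AE_restrict_space_iff)
qed

text \<open>Convexity and finiteness to the right of \<open>s\<close> give left continuity, so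
  rationals up to \<open>s\<close> suffice. With the condition \<open>q \<le> s\<close> inside the
  supremum the index set stays fixed and countable when \<open>s\<close> later depends on
  \<open>x\<close>; the default 0 never affects the supremum.\<close>

lemma M_left_continuous:
  assumes x: "x \<in> \<Omega>" and fin: "M x (s + 1) < \<infinity>" and s: "0 \<le> s"
  shows "(SUP q\<in>{q\<in>\<rat>. 0 \<le> q}. if q \<le> s then M x q else 0) = M x s"
    (is "?S = _")
proof (rule antisym)
  show "?S \<le> M x s"
    using M_mono[OF x] by (intro SUP_least) auto
  show "M x s \<le> ?S"
  proof (cases "s = 0")
    case True
    then show ?thesis using M_zero[OF x] by simp
  next
    case False
    with s have s: "s > 0" by simp
    obtain T where T: "M x (s + 1) = ennreal T" "T \<ge> 0"
      using fin by (cases "M x (s + 1)") auto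
    show ?thesis
    proof (rule ennreal_le_epsilon)
      fix e :: real assume e: "e > 0"
      \<comment> \<open>This bound makes \<open>s - q < e / (T + 1)\<close>; \<open>max 0\<close>
        keeps \<open>q\<close> nonnegative, and \<open>T + 1\<close> avoids dividing by
        zero.\<close>
      have "max 0 (s - min 1 (e / (T + 1))) < s"
        using s e T by auto
      then obtain q where q: "q \<in> \<rat>" "max 0 (s - min 1 (e / (T + 1))) < q" "q < s"
        using Rats_dense_in_real by blast
      \<comment> \<open>The weight that makes \<open>s\<close> a convex combination of
        \<open>q\<close> and \<open>s + 1\<close>. The estimate
        \<open>1 - \<theta> \<le> s - q\<close> amounts to \<open>(s - q)^2 \<ge> 0\<close>.\<close>
      define \<theta> where "\<theta> = 1 / (s + 1 - q)"
      have \<theta>: "0 \<le> \<theta>" "\<theta> \<le> 1" "1 - \<theta> \<le> s - q"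
        using q zero_le_power2[of "s - q"]
        by (auto simp: \<theta>_def field_simps power2_eq_square)
      have "\<theta> * (s + 1 - q) = 1"
        using q by (simp add: \<theta>_def)
      then have "s = \<theta> * q + (1 - \<theta>) * (s + 1)"
        by (simp add: algebra_simps)
      then have "M x s \<le> ennreal \<theta> * M x q + ennreal (1 - \<theta>) * M x (s + 1)"
        using M_convex[OF x, of q "s + 1" \<theta>] q s \<theta> by simp
      also have "\<dots> \<le> 1 * M x q + ennreal e"
      proof (rule add_mono)
        show "ennreal \<theta> * M x q \<le> 1 * M x q"
          using \<theta> by (intro mult_right_mono) auto
        have "(1 - \<theta>) * T \<le> (e / (T + 1)) * T"
          using \<theta> q T by (intro mult_right_mono) auto
        also have "\<dots> \<le> e"
          using e T by (simp add: field_simps)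
        finally show "ennreal (1 - \<theta>) * M x (s + 1) \<le> ennreal e"
          using T \<theta> by (simp add: ennreal_mult[symmetric] ennreal_leI)
      qed
      also have "1 * M x q \<le> ?S"
        using q by (intro SUP_upper2[of q]) auto
      finally show "M x s \<le> ?S + ennreal e"
        by (simp add: add_right_mono)
    qed
  qed
qed

text \<open>\<open>M\<close> is measurable in \<open>x\<close> only for a fixed second argument. The
  countable supremum \<open>?G\<close> uses just such fixed arguments and agrees a.e. with the
  composition, so completeness of Lebesgue measure finishes the argument.\<close>

lemma measurable_M_compose:
  assumes f[measurable]: "f \<in> borel_measurable (lebesgue_on \<Omega>)" and nn: "\<And>x. 0 \<le> f x"
  shows "(\<lambda>x. M x (f x)) \<in> borel_measurable (lebesgue_on \<Omega>)"
proof -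
  interpret complete_measure "lebesgue_on \<Omega>"
    by (rule complete_measure_lebesgue_on[OF sets_\<Omega>])
  let ?G = "\<lambda>x. SUP q\<in>{q\<in>\<rat>. 0 \<le> q}. if q \<le> f x then M x q else 0"
  show ?thesis
  proof (rule measurable_cong_AE_complete)
    have "countable {q\<in>\<rat>. (0::real) \<le> q}"
      using countable_rat by (rule countable_subset[rotated]) auto
    moreover have "(\<lambda>x. if q \<le> f x then M x q else 0) \<in> borel_measurable (lebesgue_on \<Omega>)"
      if "q \<in> {q\<in>\<rat>. 0 \<le> q}" for q
    proof -
      have [measurable]: "(\<lambda>x. M x q) \<in> borel_measurable (lebesgue_on \<Omega>)"
        using that by (intro M_measurable) auto
      show ?thesis by measurable
    qed
    ultimately show "?G \<in> borel_measurable (lebesgue_on \<Omega>)"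
      by (rule borel_measurable_SUP)
    show "AE x in lebesgue_on \<Omega>. ?G x = M x (f x)"
      using AE_M_finite AE_space
    proof eventually_elim
      case (elim x)
      then show ?case
        using nn[of x] by (intro M_left_continuous) auto
    qed
  qed auto
qed

section \<open>The modular\<close>

lemma measurable_modular_integrand [measurable]:
  assumes [measurable]: "u \<in> borel_measurable (lebesgue_on \<Omega>)" and "r > 0"
  shows "(\<lambda>x. M x (\<bar>u x\<bar> / r)) \<in> borel_measurable (lebesgue_on \<Omega>)"
  using assms(2) by (intro measurable_M_compose) auto

text \<open>The triangle inequality at the level of the modular:
  \<open>\<bar>u + v\<bar> / (r + s)\<close> is at most the convex combination of
  \<open>\<bar>u\<bar> / r\<close> and \<open>\<bar>v\<bar> / s\<close> with weights
  \<open>r / (r + s)\<close> and \<open>s / (r + s)\<close>.\<close>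

lemma modular_add:
  assumes [measurable]: "u \<in> borel_measurable (lebesgue_on \<Omega>)" "v \<in> borel_measurable (lebesgue_on \<Omega>)"
    and r: "r > 0" and s: "s > 0"
  shows "modular \<Omega> M (\<lambda>x. u x + v x) (r + s) \<le>
    ennreal (r / (r + s)) * modular \<Omega> M u r + ennreal (s / (r + s)) * modular \<Omega> M v s"
proof -
  define \<theta> where "\<theta> = r / (r + s)"
  have \<theta>: "0 \<le> \<theta>" "\<theta> \<le> 1" "1 - \<theta> = s / (r + s)"
    using r s by (auto simp: \<theta>_def field_simps)
  note [measurable] = measurable_modular_integrand[OF _ r] measurable_modular_integrand[OF _ s]
  have "M x (\<bar>u x + v x\<bar> / (r + s)) \<le>
      ennreal \<theta> * M x (\<bar>u x\<bar> / r) + ennreal (1 - \<theta>) * M x (\<bar>v x\<bar> / s)" if x: "x \<in> \<Omega>" for x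
  proof -
    have "\<theta> * (\<bar>u x\<bar> / r) + (1 - \<theta>) * (\<bar>v x\<bar> / s) = (\<bar>u x\<bar> + \<bar>v x\<bar>) / (r + s)"
      unfolding \<theta>(3) using r s by (simp add: \<theta>_def add_divide_distrib)
    moreover have "\<bar>u x + v x\<bar> / (r + s) \<le> (\<bar>u x\<bar> + \<bar>v x\<bar>) / (r + s)"
      using r s by (intro divide_right_mono) auto
    ultimately have "M x (\<bar>u x + v x\<bar> / (r + s)) \<le> M x (\<theta> * (\<bar>u x\<bar> / r) + (1 - \<theta>) * (\<bar>v x\<bar> / s))"
      using r s by (intro M_mono[OF x]) auto
    also have "\<dots> \<le> ennreal \<theta> * M x (\<bar>u x\<bar> / r) + ennreal (1 - \<theta>) * M x (\<bar>v x\<bar> / s)"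
      using r s \<theta> by (intro M_convex[OF x]) auto
    finally show ?thesis .
  qed
  then have "modular \<Omega> M (\<lambda>x. u x + v x) (r + s) \<le>
      (\<integral>\<^sup>+x. ennreal \<theta> * M x (\<bar>u x\<bar> / r) + ennreal (1 - \<theta>) * M x (\<bar>v x\<bar> / s) \<partial>(lebesgue_on \<Omega>))"
    unfolding modular_def by (intro nn_integral_mono) auto
  also have "\<dots> = ennreal \<theta> * modular \<Omega> M u r + ennreal (1 - \<theta>) * modular \<Omega> M v s"
    unfolding modular_def by (simp add: nn_integral_add nn_integral_cmult)
  finally show ?thesis
    unfolding \<theta>(3) by (simp add: \<theta>_def)
qed

text \<open>Used in two directions: enlarging the radius brings a finite modular below 1, and a
  modular at most 1 at small radii forces a small modular at radius 1.\<close>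

lemma modular_scale:
  assumes [measurable]: "u \<in> borel_measurable (lebesgue_on \<Omega>)" and r: "r > 0" and t: "t \<ge> 1"
  shows "modular \<Omega> M u (t * r) \<le> ennreal (1 / t) * modular \<Omega> M u r"
proof -
  note [measurable] = measurable_modular_integrand[OF _ r]
  have "M x (\<bar>u x\<bar> / (t * r)) \<le> ennreal (1 / t) * M x (\<bar>u x\<bar> / r)" if x: "x \<in> \<Omega>" for x
    using M_scale[OF x, of "\<bar>u x\<bar> / r" "1 / t"] r t by (simp add: field_simps)
  then have "modular \<Omega> M u (t * r) \<le> (\<integral>\<^sup>+x. ennreal (1 / t) * M x (\<bar>u x\<bar> / r) \<partial>(lebesgue_on \<Omega>))"
    unfolding modular_def by (intro nn_integral_mono) auto
  then show ?thesis
    unfolding modular_def by (simp add: nn_integral_cmult)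
qed

lemma modular_antimono:
  assumes "0 < r" "r \<le> s"
  shows "modular \<Omega> M u s \<le> modular \<Omega> M u r"
  unfolding modular_def using assms
  by (intro nn_integral_mono M_mono divide_left_mono) auto

lemma modular_cong_AE:
  "AE x in lebesgue_on \<Omega>. u x = v x \<Longrightarrow> modular \<Omega> M u r = modular \<Omega> M v r"
  unfolding modular_def by (rule nn_integral_cong_AE) (auto elim: eventually_mono)

lemma modular_minus: "modular \<Omega> M (\<lambda>x. u x - v x) r = modular \<Omega> M (\<lambda>x. v x - u x) r"
  unfolding modular_def by (simp add: abs_minus_commute)

section \<open>Linear structure of the functions in E\<close>

lemma E_functions_iff:
  "u \<in> E_functions \<Omega> M \<longleftrightarrow>
    u \<in> borel_measurable (lebesgue_on \<Omega>) \<and> (\<forall>r>0. modular \<Omega> M u r < \<infinity>)"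
  unfolding E_functions_def L_functions_def using zero_less_one by blast

lemma E_functions_measurable: "u \<in> E_functions \<Omega> M \<Longrightarrow> u \<in> borel_measurable (lebesgue_on \<Omega>)"
  by (simp add: E_functions_iff)

lemma E_functions_uminus:
  "u \<in> E_functions \<Omega> M \<Longrightarrow> (\<lambda>x. - u x) \<in> E_functions \<Omega> M"
  by (auto simp: E_functions_iff modular_def)

lemma E_functions_add:
  assumes u: "u \<in> E_functions \<Omega> M" and v: "v \<in> E_functions \<Omega> M"
  shows "(\<lambda>x. u x + v x) \<in> E_functions \<Omega> M"
  unfolding E_functions_iff
proof (intro conjI allI impI)
  show "(\<lambda>x. u x + v x) \<in> borel_measurable (lebesgue_on \<Omega>)"
    using u v by (auto simp: E_functions_iff)
  fix r :: real assume r: "r > 0"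
  have fin: "ennreal c * modular \<Omega> M u (r/2) < \<infinity>" "ennreal c * modular \<Omega> M v (r/2) < \<infinity>" for c
    using u v r by (auto simp: E_functions_iff ennreal_mult_less_top)
  have "modular \<Omega> M (\<lambda>x. u x + v x) (r/2 + r/2) \<le>
    ennreal (r/2 / (r/2 + r/2)) * modular \<Omega> M u (r/2) + ennreal (r/2 / (r/2 + r/2)) * modular \<Omega> M v (r/2)"
    using u v r by (intro modular_add) (auto simp: E_functions_iff)
  also have "\<dots> < \<infinity>"
    using fin by (simp only: ennreal_add_less_top infinity_ennreal_def simp_thms)
  finally show "modular \<Omega> M (\<lambda>x. u x + v x) r < \<infinity>"
    by simp
qed

lemma E_functions_diff:
  assumes u: "u \<in> E_functions \<Omega> M" and v: "v \<in> E_functions \<Omega> M"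
  shows "(\<lambda>x. u x - v x) \<in> E_functions \<Omega> M"
  using E_functions_add[OF u E_functions_uminus[OF v]] by simp

lemma E_functions_cong_AE:
  assumes "u \<in> E_functions \<Omega> M" "v \<in> borel_measurable (lebesgue_on \<Omega>)"
    and "AE x in lebesgue_on \<Omega>. u x = v x"
  shows "v \<in> E_functions \<Omega> M"
  using assms(1,2) modular_cong_AE[OF assms(3)] by (simp add: E_functions_iff)

section \<open>The Luxemburg norm\<close>

lemma luxemburg_norm_le:
  assumes "r > 0" "modular \<Omega> M u r \<le> 1"
  shows "luxemburg_norm \<Omega> M u \<le> r"
  unfolding luxemburg_norm_def using assms
  by (intro cInf_lower bdd_belowI[of _ 0]) auto

text \<open>The infimum of an empty set of reals carries no information, so lower bounds on the norm
  and the extraction of admissible radii rest on this. If the modular at 1 is \<open>a\<close>,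
  scaling shows that the radius \<open>max 1 a\<close> is admissible.\<close>

lemma luxemburg_norm_set_nonempty:
  assumes u: "u \<in> E_functions \<Omega> M"
  shows "{r. r > 0 \<and> modular \<Omega> M u r \<le> 1} \<noteq> {}"
proof -
  have "modular \<Omega> M u 1 < \<infinity>"
    using u unfolding E_functions_iff by simp
  then obtain a where a: "modular \<Omega> M u 1 = ennreal a" "a \<ge> 0"
    by (cases "modular \<Omega> M u 1") auto
  have "modular \<Omega> M u (max 1 a * 1) \<le> ennreal (1 / max 1 a) * modular \<Omega> M u 1"
    using u by (intro modular_scale) (auto simp: E_functions_iff)
  also have "\<dots> = ennreal (a / max 1 a)"
    using a by (simp add: ennreal_mult[symmetric])
  also have "\<dots> \<le> 1"
    using a by (simp add: field_simps)
  finally show ?thesis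
    by (auto intro!: exI[of _ "max 1 a"])
qed

lemma luxemburg_norm_nonneg:
  "u \<in> E_functions \<Omega> M \<Longrightarrow> 0 \<le> luxemburg_norm \<Omega> M u"
  unfolding luxemburg_norm_def
  by (rule cInf_greatest[OF luxemburg_norm_set_nonempty]) auto

text \<open>The strict inequality leaves room for an admissible radius below \<open>r\<close>, so
  whether the infimum is attained never matters.\<close>

lemma modular_le_1:
  assumes "u \<in> E_functions \<Omega> M" "luxemburg_norm \<Omega> M u < r"
  shows "modular \<Omega> M u r \<le> 1"
proof -
  obtain s where "s > 0" "modular \<Omega> M u s \<le> 1" "s < r"
    using cInf_lessD[OF luxemburg_norm_set_nonempty[OF assms(1)]] assms(2)
    unfolding luxemburg_norm_def by auto
  then show ?thesis
    using modular_antimono[of s r u] by auto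
qed

text \<open>Radii exceeding the two norms by \<open>e / 2\<close> have modulars at most 1, and
  \<open>modular_add\<close> bounds the modular of the sum by a convex combination of these.\<close>

lemma luxemburg_norm_add:
  assumes u: "u \<in> E_functions \<Omega> M" and v: "v \<in> E_functions \<Omega> M"
  shows "luxemburg_norm \<Omega> M (\<lambda>x. u x + v x) \<le> luxemburg_norm \<Omega> M u + luxemburg_norm \<Omega> M v"
proof (rule field_le_epsilon)
  fix e :: real assume e: "e > 0"
  define r where "r = luxemburg_norm \<Omega> M u + e / 2"
  define s where "s = luxemburg_norm \<Omega> M v + e / 2"
  have rs: "r > 0" "s > 0"
    using luxemburg_norm_nonneg[OF u] luxemburg_norm_nonneg[OF v] e by (auto simp: r_def s_def)
  have "modular \<Omega> M (\<lambda>x. u x + v x) (r + s) \<le>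
    ennreal (r / (r + s)) * modular \<Omega> M u r + ennreal (s / (r + s)) * modular \<Omega> M v s"
    using u v rs by (intro modular_add) (auto simp: E_functions_iff)
  also have "\<dots> \<le> ennreal (r / (r + s)) * 1 + ennreal (s / (r + s)) * 1"
    using u v e by (intro add_mono mult_left_mono modular_le_1) (auto simp: r_def s_def)
  also have "\<dots> = 1"
    using rs by (simp add: ennreal_plus[symmetric] add_divide_distrib[symmetric] del: ennreal_plus)
  finally have "luxemburg_norm \<Omega> M (\<lambda>x. u x + v x) \<le> r + s"
    using rs by (intro luxemburg_norm_le) auto
  then show "luxemburg_norm \<Omega> M (\<lambda>x. u x + v x) \<le>
      luxemburg_norm \<Omega> M u + luxemburg_norm \<Omega> M v + e"
    by (simp add: r_def s_def)
qed

lemma luxemburg_norm_minus: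
  "luxemburg_norm \<Omega> M (\<lambda>x. u x - v x) = luxemburg_norm \<Omega> M (\<lambda>x. v x - u x)"
  unfolding luxemburg_norm_def by (subst modular_minus) (rule refl)

lemma luxemburg_norm_cong_AE:
  "AE x in lebesgue_on \<Omega>. u x = v x \<Longrightarrow> luxemburg_norm \<Omega> M u = luxemburg_norm \<Omega> M v"
  unfolding luxemburg_norm_def by (simp add: modular_cong_AE)

lemma luxemburg_norm_zero_fun: "luxemburg_norm \<Omega> M (\<lambda>x. 0) \<le> 0"
proof (rule field_le_epsilon)
  fix e :: real assume "e > 0"
  moreover have "modular \<Omega> M (\<lambda>x. 0) e = (\<integral>\<^sup>+x. 0 \<partial>(lebesgue_on \<Omega>))"
    unfolding modular_def by (rule nn_integral_cong) (simp add: M_zero)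
  ultimately show "luxemburg_norm \<Omega> M (\<lambda>x. 0) \<le> 0 + e"
    by (simp add: luxemburg_norm_le)
qed

text \<open>Norm 0 makes the modular at most 1 at every radius \<open>1 / t\<close>; scaling up by
  \<open>t\<close> bounds the modular at 1 by \<open>1 / t\<close>. Hence it vanishes, and
  positivity of \<open>M x\<close> away from 0 leaves only \<open>u x = 0\<close> a.e.\<close>

lemma luxemburg_norm_eq_0D:
  assumes u: "u \<in> E_functions \<Omega> M" and 0: "luxemburg_norm \<Omega> M u = 0"
  shows "AE x in lebesgue_on \<Omega>. u x = 0"
proof -
  have m: "u \<in> borel_measurable (lebesgue_on \<Omega>)"
    using u by (rule E_functions_measurable)
  have "modular \<Omega> M u 1 \<le> 0"
  proof (rule ennreal_le_epsilon)
    fix e :: real assume e: "e > 0"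
    define t where "t = max 1 (1 / e)"
    have t: "t \<ge> 1" "1 / t \<le> e"
      using e by (auto simp: t_def field_simps max_def)
    have "modular \<Omega> M u 1 = modular \<Omega> M u (t * (1 / t))"
      using t by simp
    also have "\<dots> \<le> ennreal (1 / t) * modular \<Omega> M u (1 / t)"
      using t m by (intro modular_scale) auto
    also have "\<dots> \<le> ennreal (1 / t) * 1"
      using t 0 u by (intro mult_left_mono modular_le_1) auto
    also have "\<dots> \<le> 0 + ennreal e"
      using t by (simp add: ennreal_leI)
    finally show "modular \<Omega> M u 1 \<le> 0 + ennreal e" .
  qed
  then have "AE x in lebesgue_on \<Omega>. M x (\<bar>u x\<bar> / 1) = 0"
    using nn_integral_0_iff_AE[OF measurable_modular_integrand[OF m zero_less_one]]
    unfolding modular_def by simp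
  then show ?thesis
    using AE_space
  proof eventually_elim
    case (elim x)
    then show ?case
      using M_pos[of x "\<bar>u x\<bar>"] by force
  qed
qed

section \<open>Classes modulo a.e. equality and their metric\<close>

lemma equiv_ae_eq: "equiv (borel_measurable (lebesgue_on \<Omega>)) (ae_eq \<Omega>)"
proof (rule equivI)
  show "sym (ae_eq \<Omega>)"
    by (rule symI) (auto simp: ae_eq_def elim: eventually_mono)
  show "trans (ae_eq \<Omega>)"
  proof (rule transI)
    fix u v w assume *: "(u, v) \<in> ae_eq \<Omega>" "(v, w) \<in> ae_eq \<Omega>"
    then have "AE x in lebesgue_on \<Omega>. u x = v x" "AE x in lebesgue_on \<Omega>. v x = w x"
      by (auto simp: ae_eq_def)
    then have "AE x in lebesgue_on \<Omega>. u x = w x"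
      by eventually_elim simp
    with * show "(u, w) \<in> ae_eq \<Omega>"
      by (auto simp: ae_eq_def)
  qed
qed (auto simp: ae_eq_def refl_on_def)

lemma E_space_class:
  "u \<in> E_functions \<Omega> M \<Longrightarrow> ae_eq \<Omega> `` {u} \<in> E_space \<Omega> M"
  unfolding E_space_def by (rule quotientI)

lemma E_space_self:
  "u \<in> E_functions \<Omega> M \<Longrightarrow> u \<in> ae_eq \<Omega> `` {u}"
  by (rule equiv_class_self[OF equiv_ae_eq]) (rule E_functions_measurable)

lemma E_space_memD:
  assumes A: "A \<in> E_space \<Omega> M" and a: "a \<in> A"
  shows "a \<in> E_functions \<Omega> M" "A = ae_eq \<Omega> `` {a}"
proof -
  obtain u where u: "u \<in> E_functions \<Omega> M" "A = ae_eq \<Omega> `` {u}"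
    using A by (auto simp: E_space_def elim: quotientE)
  with a have ua: "(u, a) \<in> ae_eq \<Omega>"
    by auto
  then show "a \<in> E_functions \<Omega> M"
    by (intro E_functions_cong_AE[OF u(1)]) (auto simp: ae_eq_def)
  show "A = ae_eq \<Omega> `` {a}"
    using equiv_class_eq[OF equiv_ae_eq ua] u by simp
qed

lemma E_space_some:
  assumes "A \<in> E_space \<Omega> M"
  shows "(SOME u. u \<in> A) \<in> A"
proof -
  obtain u where "u \<in> E_functions \<Omega> M" "A = ae_eq \<Omega> `` {u}"
    using assms by (auto simp: E_space_def elim: quotientE)
  then have "u \<in> A"
    using E_space_self by simp
  then show ?thesis
    by (rule someI[of "\<lambda>u. u \<in> A"])
qed

text \<open>Frees all later arguments from the chosen representatives: members of one class agree
  a.e., and the norm ignores null sets.\<close>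

lemma E_dist_eq:
  assumes "A \<in> E_space \<Omega> M" "B \<in> E_space \<Omega> M" and a: "a \<in> A" and b: "b \<in> B"
  shows "E_dist \<Omega> M A B = luxemburg_norm \<Omega> M (\<lambda>x. a x - b x)"
proof -
  define a' b' where "a' = (SOME u. u \<in> A)" and "b' = (SOME u. u \<in> B)"
  have "a' \<in> A" "b' \<in> B"
    using assms E_space_some by (auto simp: a'_def b'_def)
  then have "a \<in> ae_eq \<Omega> `` {a'}" "b \<in> ae_eq \<Omega> `` {b'}"
    using E_space_memD(2) assms by blast+
  then have "AE x in lebesgue_on \<Omega>. a' x = a x" "AE x in lebesgue_on \<Omega>. b' x = b x"
    by (auto simp: ae_eq_def)
  then have "AE x in lebesgue_on \<Omega>. a' x - b' x = a x - b x"
    by eventually_elim simp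
  then have "luxemburg_norm \<Omega> M (\<lambda>x. a' x - b' x) = luxemburg_norm \<Omega> M (\<lambda>x. a x - b x)"
    by (rule luxemburg_norm_cong_AE)
  then show ?thesis
    using assms by (simp add: E_dist_def a'_def b'_def)
qed

lemma luxemburg_norm_diff_triangle:
  assumes "u \<in> E_functions \<Omega> M" "v \<in> E_functions \<Omega> M" "w \<in> E_functions \<Omega> M"
  shows "luxemburg_norm \<Omega> M (\<lambda>x. u x - w x) \<le>
    luxemburg_norm \<Omega> M (\<lambda>x. u x - v x) + luxemburg_norm \<Omega> M (\<lambda>x. v x - w x)"
  using luxemburg_norm_add[OF E_functions_diff[OF assms(1,2)] E_functions_diff[OF assms(2,3)]]
  by simp

lemma Metric_space_E_space: "Metric_space (E_space \<Omega> M) (E_dist \<Omega> M)"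
proof
  \<comment> \<open>These two axioms range over arbitrary sets of functions, so the default value 0
    of \<open>E_dist\<close> comes into play here.\<close>
  fix A B
  show "0 \<le> E_dist \<Omega> M A B"
    unfolding E_dist_def
    by (auto intro!: luxemburg_norm_nonneg E_functions_diff E_space_memD(1)[OF _ E_space_some])
  show "E_dist \<Omega> M A B = E_dist \<Omega> M B A"
    unfolding E_dist_def by (subst luxemburg_norm_minus) simp
next
  fix A B assume AB: "A \<in> E_space \<Omega> M" "B \<in> E_space \<Omega> M"
  obtain a b where ab: "a \<in> A" "b \<in> B"
    using E_space_some AB by blast
  note E = E_space_memD(1)[OF AB(1) ab(1)] E_space_memD(1)[OF AB(2) ab(2)]
  show "E_dist \<Omega> M A B = 0 \<longleftrightarrow> A = B"
  proof
    assume "E_dist \<Omega> M A B = 0"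
    then have "AE x in lebesgue_on \<Omega>. a x - b x = 0"
      using E_dist_eq[OF AB ab] by (intro luxemburg_norm_eq_0D E_functions_diff E) auto
    then have "(a, b) \<in> ae_eq \<Omega>"
      using E by (simp add: ae_eq_def E_functions_measurable)
    then have "ae_eq \<Omega> `` {a} = ae_eq \<Omega> `` {b}"
      by (rule equiv_class_eq[OF equiv_ae_eq])
    then show "A = B"
      using E_space_memD(2)[OF AB(1) ab(1)] E_space_memD(2)[OF AB(2) ab(2)] by simp
  next
    assume "A = B"
    then have "E_dist \<Omega> M A B = luxemburg_norm \<Omega> M (\<lambda>x. a x - a x)"
      using E_dist_eq AB ab by simp
    moreover have "0 \<le> luxemburg_norm \<Omega> M (\<lambda>x. a x - a x)"
      by (intro luxemburg_norm_nonneg E_functions_diff E)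
    ultimately show "E_dist \<Omega> M A B = 0"
      using luxemburg_norm_zero_fun by simp
  qed
next
  fix A B C assume *: "A \<in> E_space \<Omega> M" "B \<in> E_space \<Omega> M" "C \<in> E_space \<Omega> M"
  obtain a b c where abc: "a \<in> A" "b \<in> B" "c \<in> C"
    using E_space_some * by blast
  have "a \<in> E_functions \<Omega> M" "b \<in> E_functions \<Omega> M" "c \<in> E_functions \<Omega> M"
    using * abc E_space_memD(1) by blast+
  then show "E_dist \<Omega> M A C \<le> E_dist \<Omega> M A B + E_dist \<Omega> M B C"
    using luxemburg_norm_diff_triangle E_dist_eq * abc by simp
qed

section \<open>Dominated convergence in norm\<close>

lemma M_tendsto_0:
  assumes x: "x \<in> \<Omega>" and fin: "M x 1 < \<infinity>" and f: "f \<longlonglongrightarrow> 0" "\<And>n. 0 \<le> f n"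
  shows "(\<lambda>n. M x (f n)) \<longlonglongrightarrow> 0"
proof (rule tendsto_sandwich[where f = "\<lambda>_. 0" and h = "\<lambda>n. ennreal (f n) * M x 1"])
  have "eventually (\<lambda>n. f n < 1) sequentially"
    using order_tendstoD(2)[OF f(1)] by simp
  then show "eventually (\<lambda>n. M x (f n) \<le> ennreal (f n) * M x 1) sequentially"
  proof eventually_elim
    case (elim n)
    then show ?case
      using M_scale[OF x zero_le_one f(2), of n] by simp
  qed
  obtain T where T: "M x 1 = ennreal T" "T \<ge> 0"
    using fin by (cases "M x 1") auto
  have "(\<lambda>n. ennreal (f n * T)) \<longlonglongrightarrow> ennreal (0 * T)"
    by (intro tendsto_ennrealI tendsto_intros f)
  then show "(\<lambda>n. ennreal (f n) * M x 1) \<longlonglongrightarrow> 0"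
    using T f(2) by (simp add: ennreal_mult)
qed auto

text \<open>At the fixed radius \<open>r\<close> the integrands tend to 0 a.e. and are dominated by
  that of \<open>g\<close>, whose modular is finite at every radius. Some modular at
  \<open>r\<close> thus drops below 1, which already bounds the norm by \<open>r\<close>; a single
  index is all that density asks for.\<close>

lemma luxemburg_norm_dominated:
  assumes [measurable]: "\<And>n. u n \<in> borel_measurable (lebesgue_on \<Omega>)"
    and g: "g \<in> E_functions \<Omega> M"
    and dom: "\<And>n x. x \<in> \<Omega> \<Longrightarrow> \<bar>u n x\<bar> \<le> \<bar>g x\<bar>"
    and lim: "AE x in lebesgue_on \<Omega>. (\<lambda>n. u n x) \<longlonglongrightarrow> 0"
    and r: "r > 0"
  obtains n where "luxemburg_norm \<Omega> M (u n) \<le> r"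
proof -
  have [measurable]: "g \<in> borel_measurable (lebesgue_on \<Omega>)"
    using g by (rule E_functions_measurable)
  have "(\<lambda>n. \<integral>\<^sup>+x. M x (\<bar>u n x\<bar> / r) \<partial>(lebesgue_on \<Omega>)) \<longlonglongrightarrow> (\<integral>\<^sup>+x. 0 \<partial>(lebesgue_on \<Omega>))"
  proof (rule nn_integral_dominated_convergence[where w = "\<lambda>x. M x (\<bar>g x\<bar> / r)"])
    show "(\<integral>\<^sup>+x. M x (\<bar>g x\<bar> / r) \<partial>(lebesgue_on \<Omega>)) < \<infinity>"
      using g r by (simp add: E_functions_iff modular_def)
    show "AE x in lebesgue_on \<Omega>. M x (\<bar>u n x\<bar> / r) \<le> M x (\<bar>g x\<bar> / r)" for n
      using AE_space
    proof eventually_elim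
      case (elim x)
      then show ?case
        using r dom[of x n] by (intro M_mono divide_right_mono) auto
    qed
    show "AE x in lebesgue_on \<Omega>. (\<lambda>n. M x (\<bar>u n x\<bar> / r)) \<longlonglongrightarrow> 0"
      using AE_M_finite lim AE_space
    proof eventually_elim
      case (elim x)
      then have "(\<lambda>n. \<bar>u n x\<bar> / r) \<longlonglongrightarrow> \<bar>0\<bar> / r"
        using r by (intro tendsto_intros) auto
      then show ?case
        using elim r by (intro M_tendsto_0) auto
    qed
  qed (use r in \<open>auto intro!: measurable_modular_integrand\<close>)
  then have "eventually (\<lambda>n. (\<integral>\<^sup>+x. M x (\<bar>u n x\<bar> / r) \<partial>(lebesgue_on \<Omega>)) < 1) sequentially"
    using order_tendstoD(2) by fastforce
  then obtain n where "modular \<Omega> M (u n) r \<le> 1"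
    by (auto simp: modular_def eventually_sequentially intro: less_imp_le)
  then show ?thesis
    using that luxemburg_norm_le r by blast
qed

text \<open>The integrand is at most \<open>M x (a / r)\<close> on \<open>K\<close> and 0 on the
  rest of \<Omega>, so local integrability with the constant \<open>a / r\<close> applies. Callers
  add 1 to their bound to keep \<open>a\<close> positive when \<open>n = 0\<close>.\<close>

lemma E_functions_bounded:
  assumes f: "f \<in> borel_measurable (lebesgue_on \<Omega>)" and K: "compact K" "K \<subseteq> \<Omega>"
    and bound: "\<And>x. x \<in> K \<Longrightarrow> \<bar>f x\<bar> \<le> a" and supp: "\<And>x. x \<in> \<Omega> - K \<Longrightarrow> f x = 0"
    and a: "a > 0"
  shows "f \<in> E_functions \<Omega> M"
  unfolding E_functions_iff
proof (intro conjI allI impI f)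
  fix r :: real assume r: "r > 0"
  have KL: "K \<in> sets lebesgue"
    using K(1) by (simp add: lmeasurable_compact fmeasurableD)
  have "modular \<Omega> M f r \<le> (\<integral>\<^sup>+x. M x (a / r) * indicator K x \<partial>(lebesgue_on \<Omega>))"
    unfolding modular_def
  proof (rule nn_integral_mono)
    fix x assume "x \<in> space (lebesgue_on \<Omega>)"
    then have x: "x \<in> \<Omega>" by simp
    show "M x (\<bar>f x\<bar> / r) \<le> M x (a / r) * indicator K x"
    proof (cases "x \<in> K")
      case True
      then show ?thesis
        using r bound[of x] by (simp add: M_mono[OF x] divide_right_mono)
    next
      case False
      then show ?thesis
        using supp[of x] x M_zero[OF x] by simp
    qed
  qed
  \<comment> \<open>Integrating over the whole space serves to change the domain from \<Omega> to
    \<open>K\<close>.\<close>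
  also have "\<dots> = (\<integral>\<^sup>+x. M x (a / r) * indicator K x * indicator \<Omega> x \<partial>lebesgue)"
    using sets_\<Omega> by (intro nn_integral_restrict_space) simp
  also have "\<dots> = (\<integral>\<^sup>+x. M x (a / r) * indicator K x \<partial>lebesgue)"
    using K(2) by (intro nn_integral_cong) (auto simp: indicator_def)
  also have "\<dots> = (\<integral>\<^sup>+x. M x (a / r) \<partial>(lebesgue_on K))"
    using KL by (intro nn_integral_restrict_space[symmetric]) simp
  also have "\<dots> < \<infinity>"
    using loc K a r unfolding locally_integrable_phi_def by simp
  finally show "modular \<Omega> M f r < \<infinity>" .
qed

section \<open>Density of countably many clamped step functions\<close>

lemma truncation_approx:
  assumes C: "\<And>n. compact (C n)" "\<And>n. C n \<subseteq> \<Omega>" "incseq C" "\<Union>(range C) = \<Omega>"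
    and u: "u \<in> E_functions \<Omega> M" and r: "r > 0"
  obtains n :: nat and w where "w \<in> E_functions \<Omega> M" "\<And>x. \<bar>w x\<bar> \<le> real n"
    "\<And>x. x \<notin> C n \<Longrightarrow> w x = 0" "luxemburg_norm \<Omega> M (\<lambda>x. u x - w x) \<le> r"
proof -
  \<comment> \<open>One index governs both the compact set and the height. Large values are replaced
    by 0, so \<open>\<bar>u - w n\<bar> \<le> \<bar>u\<bar>\<close> and \<open>u\<close> itself is
    the majorant; at each point of \<Omega> the difference is eventually 0.\<close>
  define w where "w n x = (if x \<in> C n \<and> \<bar>u x\<bar> \<le> real n then u x else 0)" for n x
  have [measurable]: "u \<in> borel_measurable (lebesgue_on \<Omega>)"
    using u by (rule E_functions_measurable)
  have [measurable]: "C n \<in> sets (lebesgue_on \<Omega>)" for n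
    using C(1,2)[of n] sets_\<Omega>
    by (simp add: sets_restrict_space_iff lmeasurable_compact fmeasurableD)
  have w_meas [measurable]: "w n \<in> borel_measurable (lebesgue_on \<Omega>)" for n
    unfolding w_def by measurable
  have lim: "(\<lambda>n. u x - w n x) \<longlonglongrightarrow> 0" if x: "x \<in> \<Omega>" for x
  proof -
    obtain m where m: "x \<in> C m"
      using x C(4) by blast
    obtain k :: nat where k: "\<bar>u x\<bar> \<le> real k"
      using real_arch_simple by blast
    have "u x - w n x = 0" if "n \<ge> max m k" for n
    proof -
      have "x \<in> C n"
        using m that incseqD[OF C(3), of m n] by auto
      then show ?thesis
        using k that by (auto simp: w_def)
    qed
    then show ?thesis
      by (intro tendsto_eventually eventually_sequentiallyI[of "max m k"])
  qed
  obtain n where n: "luxemburg_norm \<Omega> M (\<lambda>x. u x - w n x) \<le> r"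
  proof (rule luxemburg_norm_dominated[of "\<lambda>n x. u x - w n x" u r])
    show "AE x in lebesgue_on \<Omega>. (\<lambda>n. u x - w n x) \<longlonglongrightarrow> 0"
      using AE_space by eventually_elim (use lim in auto)
  qed (use u r that in \<open>auto simp: w_def\<close>)
  show ?thesis
  proof
    show "w n \<in> E_functions \<Omega> M"
      by (rule E_functions_bounded[where a = "real n + 1", OF w_meas C(1)[of n] C(2)[of n]])
        (auto simp: w_def)
  qed (use n in \<open>auto simp: w_def\<close>)
qed

text \<open>Clamping bounds these functions by \<open>n\<close> on \<open>K\<close> whatever the
  list, which provides a common majorant in E for the approximations.\<close>

definition clamp_step :: "(real ^ 'n) set \<Rightarrow> nat \<Rightarrow> ((real ^ 'n) set \<times> real) list \<Rightarrow> real ^ 'n \<Rightarrow> real"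
  where "clamp_step K n L x = (if x \<in> K then max (- real n) (min (real n) (step_fun L x)) else 0)"

lemma clamp_step_measurable:
  assumes B: "topological_basis B" and L: "L \<in> lists (B \<times> \<rat>)" and K: "compact K"
  shows "clamp_step K n L \<in> borel_measurable (lebesgue_on \<Omega>)"
proof -
  have [measurable]: "K \<in> sets lebesgue"
    using K by (simp add: lmeasurable_compact fmeasurableD)
  have "fst p \<in> sets lebesgue" if "p \<in> set L" for p
  proof -
    have "fst p \<in> B"
      using L that by auto
    then show ?thesis
      using topological_basis_open[OF B] by (simp add: lmeasurable_open)
  qed
  then have [measurable]: "step_fun L \<in> borel_measurable lebesgue"
    by (rule borel_measurable_step_fun)
  show ?thesis
    unfolding clamp_step_def by (rule measurable_restrict_space1) measurable
qed

lemma clamp_step_in_E_functions: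
  assumes "topological_basis B" "L \<in> lists (B \<times> \<rat>)" "compact K" "K \<subseteq> \<Omega>"
  shows "clamp_step K n L \<in> E_functions \<Omega> M"
  by (rule E_functions_bounded[where a = "real n + 1", OF clamp_step_measurable[OF assms(1-3)] assms(3,4)])
    (auto simp: clamp_step_def)

text \<open>Continuous functions \<open>g j\<close> converge to \<open>w\<close> off a negligible
  set, and on \<open>K\<close> the step function of \<open>L j\<close> differs from
  \<open>g j\<close> by less than \<open>1 / (j + 1)\<close>. So the step functions converge to
  \<open>w\<close> a.e. on \<open>K\<close>, and dominated convergence turns this into closeness in
  norm.\<close>

lemma clamp_step_approx:
  assumes B: "topological_basis B" and K: "compact K" "K \<subseteq> \<Omega>"
    and w: "w \<in> borel_measurable (lebesgue_on \<Omega>)" "\<And>x. \<bar>w x\<bar> \<le> real n" "\<And>x. x \<notin> K \<Longrightarrow> w x = 0"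
    and r: "r > 0"
  obtains L where "L \<in> lists (B \<times> \<rat>)" "luxemburg_norm \<Omega> M (\<lambda>x. w x - clamp_step K n L x) \<le> r"
proof -
  have "w measurable_on \<Omega>"
    using w(1) sets_\<Omega> by (simp add: measurable_on_iff_borel_measurable)
  then obtain N g where N: "negligible N" and g: "\<And>j. continuous_on UNIV (g j)"
    and lim: "\<And>x. x \<notin> N \<Longrightarrow> (\<lambda>j. g j x) \<longlonglongrightarrow> (if x \<in> \<Omega> then w x else 0)"
    unfolding measurable_on_def by blast
  have "\<exists>L. L \<in> lists (B \<times> \<rat>) \<and> (\<forall>x\<in>K. \<bar>g j x - step_fun L x\<bar> < inverse (real (Suc j)))" for j
    by (rule continuous_approx_step_fun[OF B K(1) g, of "inverse (real (Suc j))" j]) auto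
  then obtain L where L: "\<And>j. L j \<in> lists (B \<times> \<rat>)"
    and close: "\<And>j x. x \<in> K \<Longrightarrow> \<bar>g j x - step_fun (L j) x\<bar> < inverse (real (Suc j))"
    by metis
  have lim': "(\<lambda>j. w x - clamp_step K n (L j) x) \<longlonglongrightarrow> 0" if x: "x \<notin> N" for x
  proof (cases "x \<in> K")
    case True
    have "(\<lambda>j. g j x - step_fun (L j) x) \<longlonglongrightarrow> 0"
      using close[OF True]
      by (intro Lim_null_comparison[OF _ LIMSEQ_inverse_real_of_nat] always_eventually)
        (auto simp: less_imp_le simp del: of_nat_Suc)
    from tendsto_diff[OF lim[OF x] this] have "(\<lambda>j. step_fun (L j) x) \<longlonglongrightarrow> w x"
      using True K(2) by auto
    \<comment> \<open>Clamping is continuous and leaves \<open>w x\<close> unchanged, so it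
      preserves the limit.\<close>
    then have "(\<lambda>j. w x - max (- real n) (min (real n) (step_fun (L j) x))) \<longlonglongrightarrow>
        w x - max (- real n) (min (real n) (w x))"
      by (intro tendsto_intros)
    moreover have "max (- real n) (min (real n) (w x)) = w x"
      using w(2)[of x] by auto
    ultimately show ?thesis
      using True by (simp add: clamp_step_def)
  next
    case False
    then show ?thesis
      using w(3) by (simp add: clamp_step_def)
  qed
  \<comment> \<open>On \<open>K\<close> both \<open>w\<close> and the clamped step function are at
    most \<open>n\<close> in absolute value, and off \<open>K\<close> both vanish.\<close>
  define G where "G x = (if x \<in> K then 2 * real n else 0)" for x
  have [measurable]: "K \<in> sets (lebesgue_on \<Omega>)"
    using K sets_\<Omega> by (simp add: sets_restrict_space_iff lmeasurable_compact fmeasurableD)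
  have "G \<in> borel_measurable (lebesgue_on \<Omega>)"
    unfolding G_def by measurable
  then have G: "G \<in> E_functions \<Omega> M"
    by (rule E_functions_bounded[where a = "2 * real n + 1", OF _ K]) (auto simp: G_def)
  obtain j where "luxemburg_norm \<Omega> M (\<lambda>x. w x - clamp_step K n (L j) x) \<le> r"
  proof (rule luxemburg_norm_dominated[of "\<lambda>j x. w x - clamp_step K n (L j) x" G r])
    show "(\<lambda>x. w x - clamp_step K n (L j) x) \<in> borel_measurable (lebesgue_on \<Omega>)" for j
      by (intro borel_measurable_diff w clamp_step_measurable[OF B L K(1)])
    show "\<bar>w x - clamp_step K n (L j) x\<bar> \<le> \<bar>G x\<bar>" for j x
    proof (cases "x \<in> K")
      case True
      have "\<bar>max (- real n) (min (real n) (step_fun (L j) x))\<bar> \<le> real n"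
        by auto
      then show ?thesis
        using w(2)[of x] True unfolding G_def clamp_step_def by simp
    qed (use w(3) in \<open>simp add: clamp_step_def\<close>)
    have "AE x in lebesgue. x \<notin> N"
      using N by (simp add: negligible_iff_null_sets AE_not_in)
    then have "AE x in lebesgue_on \<Omega>. x \<notin> N"
      using sets_\<Omega> by (auto simp: AE_restrict_space_iff)
    then show "AE x in lebesgue_on \<Omega>. (\<lambda>j. w x - clamp_step K n (L j) x) \<longlonglongrightarrow> 0"
      by eventually_elim (rule lim')
  qed (use G r in auto)
  then show ?thesis
    using that L by blast
qed

lemma E_functions_countable_dense:
  obtains D where "countable D" "D \<subseteq> E_functions \<Omega> M"
    "\<And>u e. u \<in> E_functions \<Omega> M \<Longrightarrow> e > 0 \<Longrightarrow> \<exists>c\<in>D. luxemburg_norm \<Omega> M (\<lambda>x. u x - c x) < e"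
proof -
  obtain C :: "nat \<Rightarrow> (real ^ 'n) set" where C: "\<And>n. compact (C n)" "\<And>n. C n \<subseteq> \<Omega>"
      "\<And>n. C n \<subseteq> interior (C (Suc n))" "\<Union>(range C) = \<Omega>"
    by (rule open_Union_compact_subsets[OF open_\<Omega>]) (rule that)
  have inc: "incseq C"
    using C(3) interior_subset by (intro incseq_SucI) blast
  obtain B :: "(real ^ 'n) set set" where B: "countable B" "topological_basis B"
    using ex_countable_basis by blast
  \<comment> \<open>The natural number \<open>n\<close> fixes both the compact set and the height,
    and finite lists over a countable set are countable in number.\<close>
  define D where "D = (\<lambda>(n, L). clamp_step (C n) n L) ` (UNIV \<times> lists (B \<times> \<rat>))"
  show ?thesis
  proof
    show "countable D"
      unfolding D_def using B(1) countable_rat by (intro countable_image countable_SIGMA countable_lists) auto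
    show D: "D \<subseteq> E_functions \<Omega> M"
      using clamp_step_in_E_functions[OF B(2) _ C(1,2)] by (auto simp: D_def)
    fix u and e :: real assume u: "u \<in> E_functions \<Omega> M" and e: "e > 0"
    \<comment> \<open>The two approximations give non-strict bounds; errors of \<open>e / 3\<close>
      each still add up to strictly less than \<open>e\<close>.\<close>
    then have e3: "e / 3 > 0" by simp
    obtain n w where w: "w \<in> E_functions \<Omega> M" "\<And>x. \<bar>w x\<bar> \<le> real n"
      "\<And>x. x \<notin> C n \<Longrightarrow> w x = 0" "luxemburg_norm \<Omega> M (\<lambda>x. u x - w x) \<le> e / 3"
      using truncation_approx[OF C(1,2) inc C(4) u e3] by metis
    obtain L where L: "L \<in> lists (B \<times> \<rat>)"
      "luxemburg_norm \<Omega> M (\<lambda>x. w x - clamp_step (C n) n L x) \<le> e / 3"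
      using clamp_step_approx[OF B(2) C(1,2) E_functions_measurable[OF w(1)] w(2,3) e3] by metis
    have c: "clamp_step (C n) n L \<in> D"
      using L(1) by (auto simp: D_def)
    have "luxemburg_norm \<Omega> M (\<lambda>x. u x - clamp_step (C n) n L x) \<le> e / 3 + e / 3"
      using luxemburg_norm_diff_triangle[OF u w(1) subsetD[OF D c]] w(4) L(2) by linarith
    then show "\<exists>c\<in>D. luxemburg_norm \<Omega> M (\<lambda>x. u x - c x) < e"
      using c e by (intro bexI[OF _ c]) auto
  qed
qed

section \<open>Separability of the space of classes\<close>

lemma separable_E_space: "separable_space (Metric_space.mtopology (E_space \<Omega> M) (E_dist \<Omega> M))"
proof -
  interpret Metric_space "E_space \<Omega> M" "E_dist \<Omega> M"
    by (rule Metric_space_E_space)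
  obtain D where D: "countable D" "D \<subseteq> E_functions \<Omega> M"
    "\<And>u e. u \<in> E_functions \<Omega> M \<Longrightarrow> e > 0 \<Longrightarrow> \<exists>c\<in>D. luxemburg_norm \<Omega> M (\<lambda>x. u x - c x) < e"
    using E_functions_countable_dense by metis
  define Q where "Q = (\<lambda>c. ae_eq \<Omega> `` {c}) ` D"
  have Q: "Q \<subseteq> E_space \<Omega> M"
    using D(2) E_space_class by (auto simp: Q_def)
  \<comment> \<open>Density in metric form: every ball meets \<open>Q\<close>. A representative of
    \<open>A\<close> is approximated in norm by some \<open>c\<close> in \<open>D\<close>, and the
    distance of the classes is computed from these two functions.\<close>
  have "\<exists>B\<in>Q. B \<in> mball A r" if A: "A \<in> E_space \<Omega> M" and r: "r > 0" for A r
  proof -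
    obtain a where a: "a \<in> A"
      using E_space_some[OF A] by blast
    obtain c where c: "c \<in> D" "luxemburg_norm \<Omega> M (\<lambda>x. a x - c x) < r"
      using D(3)[OF E_space_memD(1)[OF A a] r] by blast
    have cQ: "ae_eq \<Omega> `` {c} \<in> Q"
      using c by (simp add: Q_def)
    have "E_dist \<Omega> M A (ae_eq \<Omega> `` {c}) < r"
      using E_dist_eq[OF A subsetD[OF Q cQ] a E_space_self[OF subsetD[OF D(2) c(1)]]] c(2) by simp
    then show ?thesis
      using cQ Q A by (intro bexI[OF _ cQ]) auto
  qed
  then have "mtopology closure_of Q = E_space \<Omega> M"
    unfolding metric_closure_of by blast
  moreover have "countable Q"
    unfolding Q_def using D(1) by simp
  ultimately show ?thesis
    unfolding separable_space_def using Q by auto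
qed

end

theorem theorem1p2:
  fixes \<Omega> :: "(real ^ 'n) set"
    and M :: "real ^ 'n \<Rightarrow> real \<Rightarrow> ennreal"
  assumes "open \<Omega>"
    and "Phi_function \<Omega> M"
    and "locally_integrable_phi \<Omega> M"
  shows "separable_space (Metric_space.mtopology (E_space \<Omega> M) (E_dist \<Omega> M))"
proof -
  interpret phi_modular \<Omega> M
    using assms by unfold_locales (simp_all add: Phi_function_def)
  show ?thesis
    by (rule separable_E_space)
qed

end
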